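(* Let $X$, $Y$ and $B$ be ccm-magmas and let $f,g\colon X\times Y\to B$ be two morphisms of ccm-magmas. Then the internal relation $R\subseteq X\times Y$ defined by \[xRy\Leftrightarrow f(x,y)=g(x,y)\] is difunctional.
   Context: A ccm-magma (commutative cancellative medial magma) is a set $A$ with a binary operation $\oplus$ such that for all $a,b,c,d\in A$: (M1) $a\oplus b=b\oplus a$; (M2) $a\oplus c=b\oplus c$ implies $a=b$; (M3) $(a\oplus b)\oplus(c\oplus d)=(a\oplus c)\oplus(b\oplus d)$. A morphism of ccm-magmas is a map preserving the binary operation. Products carry the componentwise operation. An internal relation from $X$ to $Y$ is a subalgebra of $X\times Y$ (a subset closed under $\oplus$). A relation $R\subseteq X\times Y$ is difunctional if for all $x,z\in X$ and $y,w\in Y$: $xRy$, $zRy$ and $zRw$ imply $xRw$. *)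

theory Defs
  imports "HOL-Algebra.Congruence" "HOL-Library.FuncSet"
begin

record 'a magma = "'a partial_object" +
  magma_op :: "['a, 'a] \<Rightarrow> 'a" (infixl "\<oplus>\<index>" 65)

text \<open>The carrier may be empty: no nonemptiness is required of a ccm-magma.\<close>

locale ccm_magma =
  fixes A (structure)
  assumes op_closed: "\<lbrakk>a \<in> carrier A; b \<in> carrier A\<rbrakk> \<Longrightarrow> a \<oplus> b \<in> carrier A"
    and commutative: "\<lbrakk>a \<in> carrier A; b \<in> carrier A\<rbrakk> \<Longrightarrow> a \<oplus> b = b \<oplus> a"
    and cancellative:
      "\<lbrakk>a \<in> carrier A; b \<in> carrier A; c \<in> carrier A; a \<oplus> c = b \<oplus> c\<rbrakk> \<Longrightarrow> a = b"
    and medial: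
      "\<lbrakk>a \<in> carrier A; b \<in> carrier A; c \<in> carrier A; d \<in> carrier A\<rbrakk>
        \<Longrightarrow> (a \<oplus> b) \<oplus> (c \<oplus> d) = (a \<oplus> c) \<oplus> (b \<oplus> d)"

definition magma_prod :: "('a, 'm) magma_scheme \<Rightarrow> ('b, 'n) magma_scheme \<Rightarrow> ('a \<times> 'b) magma"
    (infixr "\<times>\<times>\<^sub>M" 80) where
  "X \<times>\<times>\<^sub>M Y =
    \<lparr>carrier = carrier X \<times> carrier Y,
     magma_op = (\<lambda>p q. (fst p \<oplus>\<^bsub>X\<^esub> fst q, snd p \<oplus>\<^bsub>Y\<^esub> snd q))\<rparr>"

definition magma_hom :: "('a, 'm) magma_scheme \<Rightarrow> ('b, 'n) magma_scheme \<Rightarrow> ('a \<Rightarrow> 'b) set" where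
  "magma_hom A B =
    {h. h \<in> carrier A \<rightarrow> carrier B \<and>
        (\<forall>a\<in>carrier A. \<forall>b\<in>carrier A. h (a \<oplus>\<^bsub>A\<^esub> b) = h a \<oplus>\<^bsub>B\<^esub> h b)}"

definition submagma :: "'a set \<Rightarrow> ('a, 'm) magma_scheme \<Rightarrow> bool" where
  "submagma S A \<longleftrightarrow> S \<subseteq> carrier A \<and> (\<forall>a\<in>S. \<forall>b\<in>S. a \<oplus>\<^bsub>A\<^esub> b \<in> S)"

definition internal_relation ::
    "('a, 'm) magma_scheme \<Rightarrow> ('b, 'n) magma_scheme \<Rightarrow> ('a \<times> 'b) set \<Rightarrow> bool" where
  "internal_relation X Y R \<longleftrightarrow> submagma R (X \<times>\<times>\<^sub>M Y)"

definition difunctional :: "'a set \<Rightarrow> 'b set \<Rightarrow> ('a \<times> 'b) set \<Rightarrow> bool" where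
  "difunctional X Y R \<longleftrightarrow>
    R \<subseteq> X \<times> Y \<and>
    (\<forall>x\<in>X. \<forall>z\<in>X. \<forall>y\<in>Y. \<forall>w\<in>Y. (x, y) \<in> R \<and> (z, y) \<in> R \<and> (z, w) \<in> R \<longrightarrow> (x, w) \<in> R)"

lemma ccm_magma_prod:
  assumes "ccm_magma X" and "ccm_magma Y"
  shows "ccm_magma (X \<times>\<times>\<^sub>M Y)"
proof -
  interpret X: ccm_magma X by fact
  interpret Y: ccm_magma Y by fact
  show ?thesis
    by unfold_locales
      (auto simp: magma_prod_def X.op_closed Y.op_closed X.medial Y.medial
        intro: X.commutative Y.commutative X.cancellative Y.cancellative)
qed

end

theory Submission
  imports Defs
begin

text \<open>
  Given \<open>x R y\<close>, \<open>z R y\<close> and \<open>z R w\<close>, complete the three pairs to a rectangle with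
  fourth corner \<open>(x, w)\<close>. The two diagonals of a rectangle have the same sum in \<open>X \<times> Y\<close>,
  since only the second coordinates are exchanged and \<open>Y\<close> is commutative. Hence every
  morphism \<open>h\<close> satisfies \<open>h (x, w) \<oplus> h (z, y) = h (x, y) \<oplus> h (z, w)\<close>
  (lemma \<open>magma_hom_rectangle\<close>). The right-hand side has the same value for \<open>f\<close> and \<open>g\<close>, and so
  does the summand \<open>h (z, y)\<close> on the left; cancelling it in \<open>B\<close> gives \<open>x R w\<close>.
\<close>

lemma magma_hom_op:
  assumes "h \<in> magma_hom A B" and "a \<in> carrier A" and "b \<in> carrier A"
  shows "h (a \<oplus>\<^bsub>A\<^esub> b) = h a \<oplus>\<^bsub>B\<^esub> h b"
  using assms by (auto simp: magma_hom_def)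

lemma submagma_equalizer:
  assumes "f \<in> magma_hom A B" and "g \<in> magma_hom A B"
    and closed: "\<And>a b. \<lbrakk>a \<in> carrier A; b \<in> carrier A\<rbrakk> \<Longrightarrow> a \<oplus>\<^bsub>A\<^esub> b \<in> carrier A"
  shows "submagma {a \<in> carrier A. f a = g a} A"
  using assms by (auto simp: submagma_def magma_hom_op)

text \<open>
  Both sides are the value of \<open>h\<close> at the common sum of the two diagonals.
\<close>

lemma magma_hom_rectangle:
  assumes Y: "ccm_magma Y" and h: "h \<in> magma_hom (X \<times>\<times>\<^sub>M Y) B"
    and x: "x \<in> carrier X" and z: "z \<in> carrier X"
    and y: "y \<in> carrier Y" and w: "w \<in> carrier Y"
  shows "h (x, w) \<oplus>\<^bsub>B\<^esub> h (z, y) = h (x, y) \<oplus>\<^bsub>B\<^esub> h (z, w)"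
proof -
  have "h (x, w) \<oplus>\<^bsub>B\<^esub> h (z, y) = h (x \<oplus>\<^bsub>X\<^esub> z, w \<oplus>\<^bsub>Y\<^esub> y)"
    using magma_hom_op[OF h, of "(x, w)" "(z, y)"] x y z w by (simp add: magma_prod_def)
  also have "w \<oplus>\<^bsub>Y\<^esub> y = y \<oplus>\<^bsub>Y\<^esub> w"
    using ccm_magma.commutative[OF Y w y] .
  also have "h (x \<oplus>\<^bsub>X\<^esub> z, y \<oplus>\<^bsub>Y\<^esub> w) = h (x, y) \<oplus>\<^bsub>B\<^esub> h (z, w)"
    using magma_hom_op[OF h, of "(x, y)" "(z, w)"] x y z w by (simp add: magma_prod_def)
  finally show ?thesis .
qed

theorem proposition6p2:
  fixes X :: "('a, 'm) magma_scheme"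
    and Y :: "('b, 'n) magma_scheme"
    and B :: "('c, 'k) magma_scheme"
    and f g :: "'a \<times> 'b \<Rightarrow> 'c"
    and R :: "('a \<times> 'b) set"
  assumes "ccm_magma X" and "ccm_magma Y" and "ccm_magma B"
    and "f \<in> magma_hom (X \<times>\<times>\<^sub>M Y) B"
    and "g \<in> magma_hom (X \<times>\<times>\<^sub>M Y) B"
    and "R = {(x, y). x \<in> carrier X \<and> y \<in> carrier Y \<and> f (x, y) = g (x, y)}"
  shows "internal_relation X Y R \<and> difunctional (carrier X) (carrier Y) R"
proof
  note f = assms(4) and g = assms(5)
  have R: "R = {p \<in> carrier (X \<times>\<times>\<^sub>M Y). f p = g p}"
    using assms(6) by (auto simp: magma_prod_def)
  show "internal_relation X Y R"
    unfolding internal_relation_def R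
    using f g ccm_magma.op_closed[OF ccm_magma_prod[OF assms(1,2)]]
    by (rule submagma_equalizer)
  show "difunctional (carrier X) (carrier Y) R"
    unfolding difunctional_def
  proof (intro conjI ballI impI)
    show "R \<subseteq> carrier X \<times> carrier Y"
      using assms(6) by auto
  next
    fix x z y w
    assume mem: "x \<in> carrier X" "z \<in> carrier X" "y \<in> carrier Y" "w \<in> carrier Y"
    assume "(x, y) \<in> R \<and> (z, y) \<in> R \<and> (z, w) \<in> R"
    then have eq: "f (x, y) = g (x, y)" "f (z, y) = g (z, y)" "f (z, w) = g (z, w)"
      using assms(6) by auto
    have "f (x, w) \<oplus>\<^bsub>B\<^esub> f (z, y) = g (x, w) \<oplus>\<^bsub>B\<^esub> f (z, y)"
      using magma_hom_rectangle[OF assms(2) f mem] magma_hom_rectangle[OF assms(2) g mem]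
      by (simp add: eq)
    moreover have "f (x, w) \<in> carrier B" "g (x, w) \<in> carrier B" "f (z, y) \<in> carrier B"
      using f g mem by (auto simp: magma_hom_def magma_prod_def)
    ultimately have "f (x, w) = g (x, w)"
      using ccm_magma.cancellative[OF assms(3)] by blast
    then show "(x, w) \<in> R"
      using assms(6) mem by simp
  qed
qed

end
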